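(* Let $H$ be a connected $m$-uniform hypergraph and let $\phi: E(\overleftrightarrow{B_H}) \to \mathbb{S}_k$ be a permutation voltage assignment on $B_H$, with associated $k$-fold covering $H_B^\phi$. Then every eigenvalue of $\mathcal{A}(H)$ is an eigenvalue of $\mathcal{A}(H_B^\phi)$ (i.e. regardless of multiplicities the spectrum of $H_B^\phi$ contains that of $H$), and $\rho(H_B^\phi)=\rho(H)$. Moreover, if $k=2$ and $m$ is even, then every eigenvalue of the signed hypergraph $\Gamma(H,\phi)$ is also an eigenvalue of $\mathcal{A}(H_B^\phi)$.
   Context: A hypergraph is $m$-uniform if every edge has $m$ vertices; connectedness is via walks through edges. The incidence graph $B_H$ is the bipartite graph on $V(H)\cup E(H)$ with $v\sim e$ iff $v\in e$. $\mathbb{S}_k$ is the symmetric group on $[k]$. $\overleftrightarrow{B_H}$ replaces each edge $\{x,y\}$ of $B_H$ by arcs $(x,y)$, $(y,x)$; a permutation voltage assignment satisfies $\phi(y,x)=\phi(x,y)^{-1}$. $H_B^\phi$ is the hypergraph with vertex set $V(H)\times[k]$ and edges $(e,i)=\{(v,\phi(v,e)(i)): v\in e\}$ for $e\in E(H)$, $i\in[k]$. The adjacency tensor of an $m$-uniform hypergraph $G$ on vertices $v_1,\dots,v_n$ is the order-$m$, dimension-$n$ tensor $\mathcal{A}(G)=(a_{i_1\cdots i_m})$ with $a_{i_1\cdots i_m}=\frac{1}{(m-1)!}$ if $\{v_{i_1},\dots,v_{i_m}\}\in E(G)$ and $0$ otherwise. For a tensor $\mathcal{A}$, $(\mathcal{A}x^{m-1})_i=\sum_{i_2,\dots,i_m}a_{i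 i_2\cdots i_m}x_{i_2}\cdots x_{i_m}$; $\lambda\in\mathbb{C}$ is an eigenvalue if $\mathcal{A}x^{m-1}=\lambda x^{[m-1]}$ for some nonzero $x\in\mathbb{C}^n$, where $x^{[m-1]}=(x_1^{m-1},\dots,x_n^{m-1})$; the spectral radius $\rho$ is the largest modulus of an eigenvalue, and $\rho(G)=\rho(\mathcal{A}(G))$. The signed hypergraph $\Gamma(H,\phi)$ is $H$ with each edge $e$ given sign $\operatorname{sgn} e=\prod_{v\in e}\operatorname{sgn}\phi(v,e)$ ($\operatorname{sgn}$ = sign of a permutation); its adjacency tensor has entry $\frac{\operatorname{sgn} e}{(m-1)!}$ at $(i_1,\dots,i_m)$ if $e=\{v_{i_1},\dots,v_{i_m}\}\in E(H)$ and $0$ otherwise, and its eigenvalues are those of this tensor. *)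

theory Defs
  imports Complex_Main "HOL-Combinatorics.Permutations"
begin

record 'v hypergraph =
  verts :: "'v set"
  edges :: "'v set set"

definition wf_hypergraph :: "('v, 'r) hypergraph_scheme \<Rightarrow> bool" where
  "wf_hypergraph H \<longleftrightarrow> finite (verts H) \<and> (\<forall>e\<in>edges H. e \<subseteq> verts H)"

definition uniform :: "nat \<Rightarrow> ('v, 'r) hypergraph_scheme \<Rightarrow> bool" where
  "uniform m H \<longleftrightarrow> (\<forall>e\<in>edges H. card e = m)"

definition is_walk :: "('v, 'r) hypergraph_scheme \<Rightarrow> 'v list \<Rightarrow> 'v set list \<Rightarrow> bool" where
  "is_walk H vs es \<longleftrightarrow> length vs = Suc (length es) \<and> set vs \<subseteq> verts H \<and> set es \<subseteq> edges H \<and>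
     (\<forall>i<length es. vs ! i \<in> es ! i \<and> vs ! Suc i \<in> es ! i)"

definition connected_hypergraph :: "('v, 'r) hypergraph_scheme \<Rightarrow> bool" where
  "connected_hypergraph H \<longleftrightarrow> verts H \<noteq> {} \<and>
     (\<forall>u\<in>verts H. \<forall>v\<in>verts H. \<exists>vs es. is_walk H vs es \<and> hd vs = u \<and> last vs = v)"


definition incidence_graph_edges :: "('v, 'r) hypergraph_scheme \<Rightarrow> ('v + 'v set) set set" where
  "incidence_graph_edges H = {{Inl v, Inr e} | v e. v \<in> verts H \<and> e \<in> edges H \<and> v \<in> e}"

definition arcs_of :: "'b set set \<Rightarrow> ('b \<times> 'b) set" where
  "arcs_of F = {(x, y). {x, y} \<in> F}"

text \<open>
  The symmetric group on \<open>[k]\<close> consists of the functions that permute \<open>{1..k}\<close>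
  and are the identity elsewhere.
\<close>

definition voltage_assignment :: "nat \<Rightarrow> ('b \<times> 'b) set \<Rightarrow> ('b \<times> 'b \<Rightarrow> nat \<Rightarrow> nat) \<Rightarrow> bool" where
  "voltage_assignment k A \<phi> \<longleftrightarrow>
     (\<forall>(x, y)\<in>A. \<phi> (x, y) permutes {1..k} \<and> \<phi> (y, x) = inv (\<phi> (x, y)))"

type_synonym 'v incidence_voltage = "('v + 'v set) \<times> ('v + 'v set) \<Rightarrow> nat \<Rightarrow> nat"

definition covering ::
  "nat \<Rightarrow> ('v, 'r) hypergraph_scheme \<Rightarrow> 'v incidence_voltage \<Rightarrow> ('v \<times> nat) hypergraph" where
  "covering k H \<phi> =
     \<lparr> verts = verts H \<times> {1..k},
       edges = {{(v, \<phi> (Inl v, Inr e) i) | v. v \<in> e} | e i. e \<in> edges H \<and> i \<in> {1..k}} \<rparr>"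


record 'v signed_hypergraph = "'v hypergraph" +
  edge_sign :: "'v set \<Rightarrow> int"

definition signed_of_voltage ::
  "'v hypergraph \<Rightarrow> 'v incidence_voltage \<Rightarrow> 'v signed_hypergraph" where
  "signed_of_voltage H \<phi> =
     \<lparr> verts = verts H, edges = edges H,
       edge_sign = (\<lambda>e. \<Prod>v\<in>e. sign (\<phi> (Inl v, Inr e))) \<rparr>"


text \<open>
  A tensor of order \<open>m\<close> over an index set \<open>I\<close> is a function on the lists of length \<open>m\<close> over \<open>I\<close>;
  values at other lists are irrelevant. The tensors of a hypergraph are indexed by its
  vertices themselves, so no enumeration of the vertices is chosen.
\<close>

type_synonym 'i tensor = "'i list \<Rightarrow> complex"

definition tensor_apply :: "nat \<Rightarrow> 'i set \<Rightarrow> 'i tensor \<Rightarrow> ('i \<Rightarrow> complex) \<Rightarrow> 'i \<Rightarrow> complex" where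
  "tensor_apply m I A x i =
     (\<Sum>js | set js \<subseteq> I \<and> length js = m - 1. A (i # js) * (\<Prod>j\<leftarrow>js. x j))"

definition tensor_eigenvalue :: "nat \<Rightarrow> 'i set \<Rightarrow> 'i tensor \<Rightarrow> complex \<Rightarrow> bool" where
  "tensor_eigenvalue m I A \<mu> \<longleftrightarrow>
     (\<exists>x. (\<exists>i\<in>I. x i \<noteq> 0) \<and> (\<forall>i\<in>I. tensor_apply m I A x i = \<mu> * x i ^ (m - 1)))"

text \<open>
  The largest modulus of an eigenvalue; the value is unspecified if there is no largest one.
\<close>

definition tensor_spectral_radius :: "nat \<Rightarrow> 'i set \<Rightarrow> 'i tensor \<Rightarrow> real" where
  "tensor_spectral_radius m I A = (GREATEST r. \<exists>\<mu>. tensor_eigenvalue m I A \<mu> \<and> r = cmod \<mu>)"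

text \<open>
  For an \<open>m\<close>-uniform hypergraph and an index list of length \<open>m\<close>, membership of the underlying
  set in the edge set forces the indices to be distinct.
\<close>

definition adjacency_tensor :: "nat \<Rightarrow> ('v, 'r) hypergraph_scheme \<Rightarrow> 'v tensor" where
  "adjacency_tensor m G js = (if set js \<in> edges G then 1 / fact (m - 1) else 0)"

definition signed_adjacency_tensor :: "nat \<Rightarrow> 'v signed_hypergraph \<Rightarrow> 'v tensor" where
  "signed_adjacency_tensor m G js =
     (if set js \<in> edges G then of_int (edge_sign G (set js)) / fact (m - 1) else 0)"

definition hypergraph_eigenvalue :: "nat \<Rightarrow> 'v hypergraph \<Rightarrow> complex \<Rightarrow> bool" where
  "hypergraph_eigenvalue m G \<mu> \<longleftrightarrow> tensor_eigenvalue m (verts G) (adjacency_tensor m G) \<mu>"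

definition hypergraph_spectral_radius :: "nat \<Rightarrow> 'v hypergraph \<Rightarrow> real" where
  "hypergraph_spectral_radius m G = tensor_spectral_radius m (verts G) (adjacency_tensor m G)"

definition signed_hypergraph_eigenvalue :: "nat \<Rightarrow> 'v signed_hypergraph \<Rightarrow> complex \<Rightarrow> bool" where
  "signed_hypergraph_eigenvalue m G \<mu> \<longleftrightarrow>
     tensor_eigenvalue m (verts G) (signed_adjacency_tensor m G) \<mu>"

end

theory Submission
  imports Defs "HOL-Combinatorics.Multiset_Permutations" "HOL-Analysis.Function_Topology"
begin

text \<open>
  The adjacency tensor acts by \<open>x \<mapsto> (v \<mapsto> \<Sum>e\<ni>v. \<Prod>u\<in>e-{v}. x u)\<close>. As every edge at \<open>v\<close> has exactly one lift
  through \<open>(v, j)\<close>, an eigenvector of the base that is repeated on each fibre is an eigenvector of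
  the covering; for \<open>k = 2\<close> and even \<open>m\<close> the same works for the signed tensor with opposite values
  on the two sheets. A maximizer of \<open>\<Sum>e. \<Prod>u\<in>e. x u\<close> over the nonnegative vectors with
  \<open>\<Sum>v. x v ^ m = 1\<close> is a positive eigenvector of the connected base. The eigenvalue of a positive
  eigenvector bounds the modulus of every eigenvalue, so comparison with the lifted vector
  identifies both spectral radii.
\<close>

section \<open>The action of the adjacency tensor as a sum over edges\<close>

text \<open>The weight treats signed and unsigned tensors together. The value type is left open
  because eigenvectors are complex and the Perron vector is real.\<close>

definition edge_sum ::
  "('v set \<Rightarrow> 'a) \<Rightarrow> ('v, 'r) hypergraph_scheme \<Rightarrow> ('v \<Rightarrow> 'a::comm_semiring_1) \<Rightarrow> 'v \<Rightarrow> 'a" where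
  "edge_sum w G x v = (\<Sum>e | e \<in> edges G \<and> v \<in> e. w e * (\<Prod>u\<in>e - {v}. x u))"

lemma finite_edges: "wf_hypergraph G \<Longrightarrow> finite (edges G)"
  by (rule finite_subset[of _ "Pow (verts G)"]) (auto simp: wf_hypergraph_def)

lemma edge_subset_verts: "wf_hypergraph G \<Longrightarrow> e \<in> edges G \<Longrightarrow> e \<subseteq> verts G"
  by (auto simp: wf_hypergraph_def)

lemma finite_edge: "wf_hypergraph G \<Longrightarrow> e \<in> edges G \<Longrightarrow> finite e"
  by (meson edge_subset_verts finite_subset wf_hypergraph_def)

text \<open>Only lists \<open>js\<close> for which \<open>i # js\<close> enumerates an edge
  contribute. An edge at \<open>i\<close> arises from the \<open>fact (m - 1)\<close> orderings of
  \<open>e - {i}\<close>, all with the same term, and this count cancels the denominator of the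
  tensor.\<close>

lemma tensor_apply_eq_edge_sum:
  fixes G :: "('v, 'r) hypergraph_scheme"
  assumes wf: "wf_hypergraph G" and unif: "uniform m G"
    and A: "\<And>js. A js = (if set js \<in> edges G then w (set js) / fact (m - 1) else 0)"
  shows "tensor_apply m (verts G) A x i = edge_sum w G x i"
proof -
  define L where "L = {js. set js \<subseteq> verts G \<and> length js = m - 1}"
  define E where "E = {e \<in> edges G. i \<in> e}"
  have "finite L"
    unfolding L_def using finite_lists_length_eq[of "verts G"] wf by (simp add: wf_hypergraph_def)
  have card_e: "finite e" "card e = m" "m \<ge> 1" "card (e - {i}) = m - 1" if "e \<in> E" for e
  proof -
    show *: "finite e" "card e = m"
      using that wf unif finite_edge by (auto simp: E_def uniform_def)
    show "m \<ge> 1"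
      using that * card_gt_0_iff[of e] by (auto simp: E_def)
    show "card (e - {i}) = m - 1"
      using that * by (auto simp: E_def)
  qed
  have perms: "{js \<in> L. set (i # js) \<in> edges G} = (\<Union>e\<in>E. permutations_of_set (e - {i}))"
  proof safe
    fix js assume js: "js \<in> L" "set (i # js) \<in> edges G"
    then have E: "set (i # js) \<in> E" by (auto simp: E_def)
    \<comment> \<open>An edge of \<open>m\<close> vertices listed by \<open>m\<close> entries leaves
      no room for a repetition; \<open>m \<ge> 1\<close> makes \<open>Suc (m - 1)\<close> equal to
      \<open>m\<close>.\<close>
    then have "distinct (i # js)"
      using card_e(2,3)[OF E] js(1) by (intro card_distinct) (auto simp: L_def)
    then have "js \<in> permutations_of_set (set (i # js) - {i})"
      by (intro permutations_of_setI) auto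
    with E show "js \<in> (\<Union>e\<in>E. permutations_of_set (e - {i}))" by blast
  next
    fix e js assume e: "e \<in> E" and "js \<in> permutations_of_set (e - {i})"
    then have js: "set js = e - {i}" "distinct js"
      by (auto simp: permutations_of_set_def)
    then have "length js = m - 1"
      using card_e(4)[OF e] distinct_card by metis
    with e js show "js \<in> L"
      using edge_subset_verts[OF wf] by (auto simp: L_def E_def)
    have "insert i (set js) = e" using e js by (auto simp: E_def)
    then show "set (i # js) \<in> edges G" using e by (simp add: E_def)
  qed
  have "tensor_apply m (verts G) A x i = (\<Sum>js\<in>L. A (i # js) * (\<Prod>j\<leftarrow>js. x j))"
    by (simp add: tensor_apply_def L_def)
  also have "\<dots> = (\<Sum>js | js \<in> L \<and> set (i # js) \<in> edges G. A (i # js) * (\<Prod>j\<leftarrow>js. x j))"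
    using \<open>finite L\<close> by (intro sum.mono_neutral_right) (auto simp: A)
  also have "\<dots> = (\<Sum>e\<in>E. \<Sum>js\<in>permutations_of_set (e - {i}). A (i # js) * (\<Prod>j\<leftarrow>js. x j))"
    unfolding perms
  proof (rule sum.UNION_disjoint)
    show "finite E" using finite_edges[OF wf] by (simp add: E_def)
    \<comment> \<open>An edge at \<open>i\<close> is recovered from any ordering of
      \<open>e - {i}\<close> by putting \<open>i\<close> back.\<close>
    show "\<forall>e\<in>E. \<forall>e'\<in>E. e \<noteq> e' \<longrightarrow>
        permutations_of_set (e - {i}) \<inter> permutations_of_set (e' - {i}) = {}"
      by (auto simp: permutations_of_set_def E_def)
  qed simp
  also have "\<dots> = (\<Sum>e\<in>E. w e * (\<Prod>u\<in>e - {i}. x u))"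
  proof (rule sum.cong[OF refl])
    fix e assume e: "e \<in> E"
    have "A (i # js) * (\<Prod>j\<leftarrow>js. x j) = w e / fact (m - 1) * (\<Prod>u\<in>e - {i}. x u)"
      if "js \<in> permutations_of_set (e - {i})" for js
    proof -
      have js: "set js = e - {i}" "distinct js"
        using that by (auto simp: permutations_of_set_def)
      have "set (i # js) = e" using e js by (auto simp: E_def)
      then show ?thesis
        using e js prod.distinct_set_conv_list[of js x] by (simp add: A E_def)
    qed
    then show "(\<Sum>js\<in>permutations_of_set (e - {i}). A (i # js) * (\<Prod>j\<leftarrow>js. x j)) =
        w e * (\<Prod>u\<in>e - {i}. x u)"
      using card_e[OF e] by simp
  qed
  finally show ?thesis by (simp add: edge_sum_def E_def)
qed

lemma tensor_eigenvalue_iff_edge_sum: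
  assumes "wf_hypergraph G" and "uniform m G"
    and "\<And>js. A js = (if set js \<in> edges G then w (set js) / fact (m - 1) else 0)"
  shows "tensor_eigenvalue m (verts G) A \<mu> \<longleftrightarrow>
    (\<exists>x. (\<exists>i\<in>verts G. x i \<noteq> 0) \<and> (\<forall>i\<in>verts G. edge_sum w G x i = \<mu> * x i ^ (m - 1)))"
  using tensor_apply_eq_edge_sum[OF assms] by (simp add: tensor_eigenvalue_def)

lemma hypergraph_eigenvalue_iff:
  assumes "wf_hypergraph G" and "uniform m G"
  shows "hypergraph_eigenvalue m G \<mu> \<longleftrightarrow>
    (\<exists>x. (\<exists>i\<in>verts G. x i \<noteq> 0) \<and> (\<forall>i\<in>verts G. edge_sum (\<lambda>_. 1) G x i = \<mu> * x i ^ (m - 1)))"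
  unfolding hypergraph_eigenvalue_def
  by (rule tensor_eigenvalue_iff_edge_sum[OF assms]) (simp add: adjacency_tensor_def)

subsection \<open>Perron eigenvectors\<close>

text \<open>At a vertex where the ratio of the moduli of an eigenvector to the positive eigenvector
  is largest, the eigenvalue equation gives the bound.\<close>

lemma eigenvalue_le_of_positive_eigenvector:
  fixes G :: "'v hypergraph"
  assumes wf: "wf_hypergraph G" and unif: "uniform m G"
    and pos: "\<And>v. v \<in> verts G \<Longrightarrow> x v > (0::real)"
    and eig: "\<And>v. v \<in> verts G \<Longrightarrow> edge_sum (\<lambda>_. 1) G x v = \<rho> * x v ^ (m - 1)"
    and ev: "hypergraph_eigenvalue m G \<mu>"
  shows "cmod \<mu> \<le> \<rho>"
proof -
  obtain y where y: "\<exists>i\<in>verts G. y i \<noteq> 0"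
    "\<And>i. i \<in> verts G \<Longrightarrow> edge_sum (\<lambda>_. 1) G y i = \<mu> * y i ^ (m - 1)"
    using ev hypergraph_eigenvalue_iff[OF wf unif] by auto
  define r where "r v = cmod (y v) / x v" for v
  have fin: "finite (verts G)" using wf by (simp add: wf_hypergraph_def)
  have "Max (r ` verts G) \<in> r ` verts G"
    using fin y(1) by (intro Max_in) auto
  then obtain v where v: "v \<in> verts G" "r v = Max (r ` verts G)" by auto
  have max: "r u \<le> r v" if "u \<in> verts G" for u
    using that fin v by simp
  have le: "cmod (y u) \<le> r v * x u" if "u \<in> verts G" for u
    using max[OF that] pos[OF that] by (simp add: r_def field_simps)
  \<comment> \<open>Positivity of the maximal ratio makes \<open>y v\<close> nonzero, so that its
    power can be cancelled at the end.\<close>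
  have "r v > 0"
  proof -
    obtain i where i: "i \<in> verts G" "y i \<noteq> 0" using y(1) by auto
    then have "r i > 0" using pos by (simp add: r_def)
    with max[OF i(1)] show ?thesis by simp
  qed
  then have yv: "cmod (y v) > 0" "r v * x v = cmod (y v)"
    using pos[OF v(1)] by (auto simp: r_def zero_less_divide_iff)
  have "cmod \<mu> * cmod (y v) ^ (m - 1) = cmod (edge_sum (\<lambda>_. 1) G y v)"
    by (simp add: y(2)[OF v(1)] norm_mult norm_power)
  also have "\<dots> \<le> (\<Sum>e | e \<in> edges G \<and> v \<in> e. \<Prod>u\<in>e - {v}. cmod (y u))"
    unfolding edge_sum_def by (rule order.trans[OF norm_sum]) (simp add: prod_norm)
  \<comment> \<open>Each of the \<open>m - 1\<close> other vertices of an edge contributes at most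
    \<open>r v * x u\<close>, so \<open>r v ^ (m - 1)\<close> factors out and the eigenvalue
    equation of \<open>x\<close> applies.\<close>
  also have "\<dots> \<le> (\<Sum>e | e \<in> edges G \<and> v \<in> e. r v ^ (m - 1) * (\<Prod>u\<in>e - {v}. x u))"
  proof (rule sum_mono)
    fix e assume "e \<in> {e. e \<in> edges G \<and> v \<in> e}"
    then have e: "e \<in> edges G" "v \<in> e" by auto
    have "card (e - {v}) = m - 1"
      using e unif finite_edge[OF wf e(1)] by (auto simp: uniform_def)
    moreover have "(\<Prod>u\<in>e - {v}. cmod (y u)) \<le> (\<Prod>u\<in>e - {v}. r v * x u)"
      using edge_subset_verts[OF wf e(1)] le by (intro prod_mono) auto
    ultimately show "(\<Prod>u\<in>e - {v}. cmod (y u)) \<le> r v ^ (m - 1) * (\<Prod>u\<in>e - {v}. x u)"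
      by (simp add: prod.distrib)
  qed
  also have "\<dots> = r v ^ (m - 1) * edge_sum (\<lambda>_. 1) G x v"
    by (simp add: edge_sum_def sum_distrib_left)
  also have "\<dots> = \<rho> * (r v * x v) ^ (m - 1)"
    by (simp add: eig[OF v(1)] power_mult_distrib)
  also have "\<dots> = \<rho> * cmod (y v) ^ (m - 1)"
    by (simp add: yv(2))
  finally show ?thesis using yv(1) by simp
qed

text \<open>The positive vector, read over the complex numbers, makes \<open>\<rho>\<close> itself
  an eigenvalue, and the preceding bound makes it the largest modulus.\<close>

lemma spectral_radius_eq_of_positive_eigenvector:
  fixes G :: "'v hypergraph"
  assumes wf: "wf_hypergraph G" and unif: "uniform m G" and ne: "verts G \<noteq> {}"
    and pos: "\<And>v. v \<in> verts G \<Longrightarrow> x v > (0::real)"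
    and eig: "\<And>v. v \<in> verts G \<Longrightarrow> edge_sum (\<lambda>_. 1) G x v = \<rho> * x v ^ (m - 1)"
  shows "hypergraph_spectral_radius m G = \<rho>"
proof -
  have le: "cmod \<mu> \<le> \<rho>" if "hypergraph_eigenvalue m G \<mu>" for \<mu>
    using eigenvalue_le_of_positive_eigenvector[OF wf unif pos eig that] by blast
  have "edge_sum (\<lambda>_. 1) G (\<lambda>v. complex_of_real (x v)) v = of_real \<rho> * of_real (x v) ^ (m - 1)"
    if "v \<in> verts G" for v
  proof -
    have "edge_sum (\<lambda>_. 1) G (\<lambda>v. complex_of_real (x v)) v = of_real (edge_sum (\<lambda>_. 1) G x v)"
      by (simp add: edge_sum_def)
    with eig[OF that] show ?thesis by simp
  qed
  then have ev: "hypergraph_eigenvalue m G (of_real \<rho>)"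
    unfolding hypergraph_eigenvalue_iff[OF wf unif] using ne pos
    by (intro exI[of _ "\<lambda>v. complex_of_real (x v)"]) (auto simp: ex_in_conv less_imp_neq[symmetric])
  \<comment> \<open>Edge sums of a positive vector are nonnegative, hence so is
    \<open>\<rho>\<close>, which therefore equals its own modulus.\<close>
  have "edge_sum (\<lambda>_. 1) G x v \<ge> 0" if "v \<in> verts G" for v
    unfolding edge_sum_def using edge_subset_verts[OF wf] pos
    by (intro sum_nonneg) (auto intro!: less_imp_le prod_pos)
  with ne eig pos have "\<rho> \<ge> 0"
    by (metis all_not_in_conv zero_le_mult_iff linorder_not_less zero_less_power)
  then show ?thesis
    unfolding hypergraph_spectral_radius_def tensor_spectral_radius_def
    using ev le by (intro Greatest_equality) (auto simp: hypergraph_eigenvalue_def intro!: exI[of _ "of_real \<rho>"])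
qed

section \<open>Connectedness through vertex sets closed under edges\<close>

text \<open>Induction along the walk: consecutive vertices share an edge, and an edge that meets
  \<open>S\<close> cannot leave it.\<close>

lemma walk_stays_in_edge_closed_set:
  assumes walk: "is_walk H vs es" and S: "hd vs \<in> S"
    and closed: "\<And>e. e \<in> edges H \<Longrightarrow> e \<inter> S \<noteq> {} \<Longrightarrow> e \<subseteq> S"
  shows "last vs \<in> S"
proof -
  have len: "length vs = Suc (length es)" using walk by (simp add: is_walk_def)
  have "vs ! i \<in> S" if "i \<le> length es" for i
    using that
  proof (induction i)
    case 0
    then show ?case using S len by (cases vs) auto
  next
    case (Suc i)
    then have "vs ! i \<in> es ! i" "vs ! Suc i \<in> es ! i" "es ! i \<in> edges H"
      using walk by (auto simp: is_walk_def)
    with Suc closed show ?case by fastforce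
  qed
  then have "vs ! (length vs - 1) \<in> S" by (simp add: len)
  moreover have "vs \<noteq> []" using len by auto
  ultimately show ?thesis by (simp add: last_conv_nth)
qed

text \<open>Otherwise \<open>S\<close> would be closed under edges, and a walk from \<open>u\<close>
  could never reach \<open>v\<close>.\<close>

lemma connected_crossing_edge:
  assumes "connected_hypergraph H" and "u \<in> verts H" "u \<in> S" and "v \<in> verts H" "v \<notin> S"
  obtains e where "e \<in> edges H" "e \<inter> S \<noteq> {}" "\<not> e \<subseteq> S"
  using assms walk_stays_in_edge_closed_set[of H _ _ S] unfolding connected_hypergraph_def by metis


section \<open>Variational construction of a positive eigenvector\<close>

text \<open>For an \<open>m\<close>-uniform hypergraph with \<open>m \<ge> 1\<close> this is the
  form of degree \<open>m\<close> given by the adjacency tensor, divided by \<open>m\<close>. Its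
  partial derivative at \<open>v\<close> is \<open>edge_sum (\<lambda>_. 1) G x v\<close>.\<close>

definition edge_form :: "('v, 'r) hypergraph_scheme \<Rightarrow> ('v \<Rightarrow> real) \<Rightarrow> real" where
  "edge_form G x = (\<Sum>e\<in>edges G. \<Prod>u\<in>e. x u)"

text \<open>An edge contains \<open>v\<close> at most once, so the form is affine in each single
  coordinate. Its slope is the edge sum, so differentiation will produce the eigenvector
  equation.\<close>

lemma edge_form_fun_upd:
  assumes wf: "wf_hypergraph G"
  shows "edge_form G (x(v := t)) =
    t * edge_sum (\<lambda>_. 1) G x v + (\<Sum>e | e \<in> edges G \<and> v \<notin> e. \<Prod>u\<in>e. x u)"
proof -
  have fin: "finite (edges G)" by (rule finite_edges[OF wf])
  have split: "edges G = {e \<in> edges G. v \<in> e} \<union> {e \<in> edges G. v \<notin> e}" by auto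
  have "edge_form G (x(v := t)) =
      (\<Sum>e | e \<in> edges G \<and> v \<in> e. \<Prod>u\<in>e. (x(v := t)) u) +
      (\<Sum>e | e \<in> edges G \<and> v \<notin> e. \<Prod>u\<in>e. (x(v := t)) u)"
    unfolding edge_form_def by (subst split, rule sum.union_disjoint) (use fin in auto)
  also have "(\<Sum>e | e \<in> edges G \<and> v \<in> e. \<Prod>u\<in>e. (x(v := t)) u) = t * edge_sum (\<lambda>_. 1) G x v"
    unfolding edge_sum_def sum_distrib_left
  proof (rule sum.cong[OF refl])
    fix e assume "e \<in> {e \<in> edges G. v \<in> e}"
    then have "finite e" "v \<in> e" using finite_edge[OF wf] by auto
    moreover have "(\<Prod>u\<in>e - {v}. (x(v := t)) u) = (\<Prod>u\<in>e - {v}. x u)"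
      by (rule prod.cong) auto
    ultimately show "(\<Prod>u\<in>e. (x(v := t)) u) = t * (1 * (\<Prod>u\<in>e - {v}. x u))"
      by (subst prod.remove[of e v]) auto
  qed
  also have "(\<Sum>e | e \<in> edges G \<and> v \<notin> e. \<Prod>u\<in>e. (x(v := t)) u) =
      (\<Sum>e | e \<in> edges G \<and> v \<notin> e. \<Prod>u\<in>e. x u)"
    by (intro sum.cong prod.cong) auto
  finally show ?thesis .
qed

lemma edge_form_scale:
  assumes "uniform m G"
  shows "edge_form G (\<lambda>v. c * x v) = c ^ m * edge_form G x"
  unfolding edge_form_def sum_distrib_left using assms
  by (intro sum.cong) (auto simp: prod.distrib uniform_def)

lemma edge_form_cong:
  assumes "wf_hypergraph G" and "\<And>v. v \<in> verts G \<Longrightarrow> x v = y v"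
  shows "edge_form G x = edge_form G y"
  unfolding edge_form_def
  using assms(2) edge_subset_verts[OF assms(1)] by (intro sum.cong prod.cong) auto

text \<open>The maximum \<open>\<rho>\<close> is attained on the compact set of nonnegative vectors
  with power sum \<open>1\<close>. Both sides of the inequality are homogeneous of degree
  \<open>m\<close>, so it passes to all nonnegative vectors.\<close>

lemma edge_form_maximizer:
  fixes G :: "('v, 'r) hypergraph_scheme"
  assumes wf: "wf_hypergraph G" and unif: "uniform m G" and m: "m \<ge> 1" and ne: "verts G \<noteq> {}"
  obtains x \<rho> where "\<And>v. v \<in> verts G \<Longrightarrow> x v \<ge> 0" and "\<exists>v\<in>verts G. x v > 0"
    and "edge_form G x = \<rho> * (\<Sum>v\<in>verts G. x v ^ m)"
    and "\<And>y. (\<And>v. v \<in> verts G \<Longrightarrow> y v \<ge> 0) \<Longrightarrow> edge_form G y \<le> \<rho> * (\<Sum>v\<in>verts G. y v ^ m)"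
proof -
  define V where "V = verts G"
  define N where "N y = (\<Sum>v\<in>V. y v ^ m)" for y :: "'v \<Rightarrow> real"
  \<comment> \<open>Functions live on the whole vertex type; pinning the coordinates outside
    \<open>V\<close> to \<open>0\<close> makes the box compact by Tychonoff. The upper bound
    \<open>1\<close> is harmless, as a power sum of \<open>1\<close> forces it.\<close>
  define B where "B = (\<Pi>\<^sub>E v\<in>UNIV. if v \<in> V then {0..1} else {0::real})"
  define K where "K = B \<inter> {y. N y = 1}"
  have fin: "finite V" using wf by (simp add: wf_hypergraph_def V_def)
  have memB: "y \<in> B \<longleftrightarrow> (\<forall>v. if v \<in> V then 0 \<le> y v \<and> y v \<le> 1 else y v = 0)" for y
    by (auto simp: B_def PiE_def Pi_def split: if_splits)
  have "compact B"
    unfolding B_def compactin_euclidean_iff[symmetric] euclidean_product_topology[symmetric]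
      compactin_PiE by auto
  moreover have "closed {y. N y = 1}"
    unfolding N_def by (intro closed_Collect_eq continuous_intros continuous_on_product_coordinates)
  ultimately have "compact K" unfolding K_def by blast
  obtain v0 where v0: "v0 \<in> V" using ne by (auto simp: V_def)
  have "(\<lambda>v. if v = v0 then 1 else 0) \<in> K"
    using v0 m fin by (auto simp: K_def memB N_def if_distrib[of "\<lambda>t. t ^ m"] power_0_left cong: if_cong)
  then have "K \<noteq> {}" by blast
  moreover have "continuous_on K (edge_form G)"
    unfolding edge_form_def
    by (intro continuous_intros continuous_on_subset[OF continuous_on_product_coordinates]) auto
  ultimately obtain x where x: "x \<in> K" and max: "\<And>y. y \<in> K \<Longrightarrow> edge_form G y \<le> edge_form G x"
    using continuous_attains_sup[OF \<open>compact K\<close>] by blast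
  have Nx: "N x = 1" using x by (simp add: K_def)
  have x0: "x v \<ge> 0" if "v \<in> V" for v
    using x that by (auto simp: K_def memB)
  show ?thesis
  proof (rule that[of x "edge_form G x"])
    show "x v \<ge> 0" if "v \<in> verts G" for v using x0 that by (simp add: V_def)
    show "\<exists>v\<in>verts G. x v > 0"
    proof (rule ccontr)
      assume "\<not> ?thesis"
      then have "\<forall>v\<in>V. x v = 0" using x0 by (force simp: V_def)
      then have "N x = 0" using m by (simp add: N_def power_0_left)
      with Nx show False by simp
    qed
    show "edge_form G x = edge_form G x * (\<Sum>v\<in>verts G. x v ^ m)"
      using Nx by (simp add: N_def V_def)
    fix y :: "'v \<Rightarrow> real" assume "\<And>v. v \<in> verts G \<Longrightarrow> y v \<ge> 0"
    then have y0: "y v \<ge> 0" if "v \<in> V" for v using that by (simp add: V_def)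
    have pow_le: "y v ^ m \<le> N y" if "v \<in> V" for v
      unfolding N_def using that fin y0 by (intro member_le_sum) auto
    have N0: "N y \<ge> 0" unfolding N_def using y0 by (intro sum_nonneg) auto
    have "edge_form G y \<le> edge_form G x * N y"
    proof (cases "N y = 0")
      case True
      \<comment> \<open>A vanishing power sum forces \<open>y\<close> to vanish on \<open>V\<close>,
        where it agrees with \<open>0 * y\<close>; homogeneity of degree \<open>m \<ge> 1\<close>
        then makes the form zero.\<close>
      have "y v = 0" if "v \<in> V" for v
        using pow_le[OF that] True y0[OF that] m by (metis zero_less_power not_le order_le_less)
      then have "edge_form G y = edge_form G (\<lambda>v. 0 * y v)"
        by (intro edge_form_cong[OF wf]) (auto simp: V_def)
      also have "\<dots> = 0"
        using edge_form_scale[OF unif, of 0 y] m by (simp add: power_0_left)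
      finally show ?thesis using True by simp
    next
      case False
      \<comment> \<open>Division by the \<open>m\<close>-th root of the power sum normalizes
        \<open>y\<close>; off \<open>V\<close> the rescaled vector is set to \<open>0\<close> to lie
        in \<open>B\<close>.\<close>
      define c where "c = root m (N y)"
      have c: "c > 0" "c ^ m = N y"
        using False N0 m by (auto simp: c_def)
      define z where "z v = (if v \<in> V then y v / c else 0)" for v
      have Nz: "N z = 1"
        using False c(2) by (simp add: N_def z_def power_divide flip: sum_divide_distrib)
      have "y v \<le> c" if "v \<in> V" for v
        using pow_le[OF that] c y0[OF that] m power_mono_iff[of "y v" c m] by simp
      then have "z \<in> B" using y0 c by (auto simp: memB z_def)
      then have "edge_form G z \<le> edge_form G x" using max Nz by (simp add: K_def)
      moreover have "edge_form G y = edge_form G (\<lambda>v. c * z v)"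
        using c by (intro edge_form_cong[OF wf]) (auto simp: z_def V_def)
      ultimately show ?thesis
        using edge_form_scale[OF unif, of c z] c N0 by (simp add: mult.commute[of _ "N y"] mult_left_mono)
    qed
    then show "edge_form G y \<le> edge_form G x * (\<Sum>v\<in>verts G. y v ^ m)"
      by (simp add: N_def V_def)
  qed
qed

text \<open>A maximizer that vanishes somewhere could be improved: replace its zeros by a small \<open>t > 0\<close>.
  An edge that crosses the support contributes a gain of order \<open>t ^ j\<close> with \<open>j < m\<close>,
  while the normalization costs only \<open>t ^ m\<close>.\<close>

lemma edge_form_maximizer_pos:
  fixes G :: "('v, 'r) hypergraph_scheme"
  assumes wf: "wf_hypergraph G" and unif: "uniform m G" and m: "m \<ge> 1"
    and conn: "connected_hypergraph G"
    and nonneg: "\<And>v. v \<in> verts G \<Longrightarrow> x v \<ge> 0" and ne: "\<exists>v\<in>verts G. x v > 0"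
    and eq: "edge_form G x = \<rho> * (\<Sum>v\<in>verts G. x v ^ m)"
    and le: "\<And>y. (\<And>v. v \<in> verts G \<Longrightarrow> y v \<ge> 0) \<Longrightarrow>
      edge_form G y \<le> \<rho> * (\<Sum>v\<in>verts G. y v ^ m)"
    and v: "v \<in> verts G"
  shows "x v > 0"
proof (rule ccontr)
  assume "\<not> x v > 0"
  define V where "V = verts G"
  define S where "S = {u \<in> V. x u > 0}"
  define Z where "Z = {u \<in> V. x u = 0}"
  have fin: "finite V" using wf by (simp add: wf_hypergraph_def V_def)
  have V: "V = S \<union> Z" "S \<inter> Z = {}"
    using nonneg by (force simp: S_def Z_def V_def)+
  obtain u where u: "u \<in> verts G" "u \<in> S" using ne by (auto simp: S_def V_def)
  have "v \<notin> S" using \<open>\<not> x v > 0\<close> by (simp add: S_def)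
  \<comment> \<open>Connectedness supplies an edge that joins the support to the zero set.\<close>
  then obtain e where e: "e \<in> edges G" "e \<inter> S \<noteq> {}" "\<not> e \<subseteq> S"
    using connected_crossing_edge[OF conn u v] by metis
  have eV: "e \<subseteq> V" "finite e" "card e = m"
    using e(1) edge_subset_verts[OF wf] finite_edge[OF wf] unif by (auto simp: V_def uniform_def)
  have e_split: "e = (e \<inter> S) \<union> (e \<inter> Z)" "(e \<inter> S) \<inter> (e \<inter> Z) = {}"
    using eV V by auto
  \<comment> \<open>\<open>j\<close> counts the zeros on the crossing edge and \<open>c\<close> is
    the product of its positive entries, so the edge will be worth \<open>c * t ^ j\<close>. It
    meets the support, whence \<open>j < m\<close>.\<close>
  define j where "j = card (e \<inter> Z)"
  define c where "c = (\<Prod>u\<in>e \<inter> S. x u)"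
  have "c > 0" unfolding c_def by (intro prod_pos) (auto simp: S_def)
  have "card (e \<inter> S) > 0" using e(2) eV by (simp add: card_gt_0_iff)
  moreover have "card e = card (e \<inter> S) + j"
    unfolding j_def by (subst e_split(1), rule card_Un_disjoint) (use eV V in auto)
  ultimately have "j < m" using eV by simp
  define y where "y t u = (if u \<in> Z then t else x u)" for t :: real and u
  have bound: "c * t ^ j \<le> \<rho> * (real (card Z) * t ^ m)" if t: "t > 0" for t
  proof -
    have y0: "y t u \<ge> 0" and xy: "x u \<le> y t u" if "u \<in> V" for u
      using that t nonneg by (auto simp: y_def V_def Z_def)
    have prod_le: "(\<Prod>u\<in>f. x u) \<le> (\<Prod>u\<in>f. y t u)" if "f \<in> edges G" for f
      using edge_subset_verts[OF wf that] nonneg xy by (intro prod_mono) (auto simp: V_def)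
    have "(\<Prod>u\<in>e. y t u) = (\<Prod>u\<in>e \<inter> S. y t u) * (\<Prod>u\<in>e \<inter> Z. y t u)"
      by (subst e_split(1), rule prod.union_disjoint) (use eV V in auto)
    also have "(\<Prod>u\<in>e \<inter> S. y t u) = c"
      unfolding c_def using V by (intro prod.cong) (auto simp: y_def)
    also have "(\<Prod>u\<in>e \<inter> Z. y t u) = t ^ j"
      by (simp add: y_def j_def)
    finally have ye: "(\<Prod>u\<in>e. y t u) = c * t ^ j" .
    have "\<exists>u\<in>e. u \<in> Z" using e(3) eV(1) V(1) by blast
    then have "\<exists>u\<in>e. x u = 0" by (auto simp: Z_def)
    then have xe: "(\<Prod>u\<in>e. x u) = 0" using eV by simp
    \<comment> \<open>The crossing edge rises from \<open>0\<close> to \<open>c * t ^ j\<close>, and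
      no other edge loses because \<open>x \<le> y t\<close> on the vertices.\<close>
    have "edge_form G x + c * t ^ j = c * t ^ j + (\<Sum>f\<in>edges G - {e}. \<Prod>u\<in>f. x u)"
      unfolding edge_form_def using e(1) xe by (subst sum.remove[OF finite_edges[OF wf] e(1)]) simp
    also have "\<dots> \<le> (\<Prod>u\<in>e. y t u) + (\<Sum>f\<in>edges G - {e}. \<Prod>u\<in>f. y t u)"
      unfolding ye using prod_le by (intro add_mono sum_mono) auto
    also have "\<dots> = edge_form G (y t)"
      unfolding edge_form_def by (rule sum.remove[OF finite_edges[OF wf] e(1), symmetric])
    also have "\<dots> \<le> \<rho> * (\<Sum>u\<in>V. y t u ^ m)"
      using le[of "y t"] y0 by (simp add: V_def)
    also have "(\<Sum>u\<in>V. y t u ^ m) = (\<Sum>u\<in>V. x u ^ m + (if u \<in> Z then t ^ m else 0))"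
      using m by (intro sum.cong) (auto simp: y_def Z_def power_0_left)
    also have "\<dots> = (\<Sum>u\<in>V. x u ^ m) + real (card Z) * t ^ m"
    proof -
      have "V \<inter> {u. u \<in> Z} = Z" by (auto simp: Z_def)
      then show ?thesis using fin by (simp add: sum.distrib sum.If_cases)
    qed
    finally show ?thesis using eq by (simp add: V_def algebra_simps)
  qed
  \<comment> \<open>After division by \<open>t ^ j\<close> the cost keeps the positive power
    \<open>t ^ (m - j)\<close> and vanishes as \<open>t\<close> tends to \<open>0\<close> from the
    right, against the fixed gain \<open>c > 0\<close>.\<close>
  have "c \<le> \<rho> * real (card Z) * t ^ (m - j)" if t: "t > 0" for t
  proof -
    have "t ^ m = t ^ (m - j) * t ^ j" using \<open>j < m\<close> by (simp flip: power_add)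
    then have "c * t ^ j \<le> (\<rho> * real (card Z) * t ^ (m - j)) * t ^ j"
      using bound[OF t] by (simp add: mult.assoc)
    then show ?thesis using t by simp
  qed
  then have "\<forall>\<^sub>F t in at_right 0. c \<le> \<rho> * real (card Z) * t ^ (m - j)"
    by (auto simp: eventually_at_right_less intro: eventually_mono[OF eventually_at_right_less])
  moreover have "((\<lambda>t::real. \<rho> * real (card Z) * t ^ (m - j)) \<longlongrightarrow> \<rho> * real (card Z) * 0 ^ (m - j)) (at_right 0)"
    by (intro tendsto_intros)
  ultimately have "c \<le> \<rho> * real (card Z) * 0 ^ (m - j)"
    by (intro tendsto_lowerbound) auto
  with \<open>c > 0\<close> \<open>j < m\<close> show False by (simp add: power_0_left)
qed

text \<open>All but one coordinate of the maximizer are frozen. The slack of its inequality is then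
  a function of one variable with an interior minimum, and its vanishing derivative is the
  eigenvector equation at that vertex.\<close>

lemma positive_eigenvector_exists:
  fixes G :: "('v, 'r) hypergraph_scheme"
  assumes wf: "wf_hypergraph G" and unif: "uniform m G" and conn: "connected_hypergraph G"
  obtains x \<rho> where "\<And>v. v \<in> verts G \<Longrightarrow> x v > (0::real)"
    and "\<And>v. v \<in> verts G \<Longrightarrow> edge_sum (\<lambda>_. 1) G x v = \<rho> * x v ^ (m - 1)"
proof (cases "m = 0")
  case True
  \<comment> \<open>For \<open>m = 0\<close> every edge is empty, so all edge sums vanish and the
    constant vector serves with eigenvalue \<open>0\<close>.\<close>
  then have no_edges: "{e. e \<in> edges G \<and> v \<in> e} = {}" for v
    using unif finite_edge[OF wf] by (fastforce simp: uniform_def)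
  show ?thesis by (rule that[of "\<lambda>_. 1" 0]) (simp_all only: edge_sum_def no_edges, simp_all)
next
  case False
  then have m: "m \<ge> 1" by simp
  have ne: "verts G \<noteq> {}" using conn by (simp add: connected_hypergraph_def)
  obtain x \<rho> where x: "\<And>v. v \<in> verts G \<Longrightarrow> x v \<ge> 0" "\<exists>v\<in>verts G. x v > 0"
      "edge_form G x = \<rho> * (\<Sum>v\<in>verts G. x v ^ m)"
      "\<And>y. (\<And>v. v \<in> verts G \<Longrightarrow> y v \<ge> 0) \<Longrightarrow> edge_form G y \<le> \<rho> * (\<Sum>v\<in>verts G. y v ^ m)"
    by (rule edge_form_maximizer[OF wf unif m ne]) blast
  have pos: "x v > 0" if "v \<in> verts G" for v
    using edge_form_maximizer_pos[OF wf unif m conn x that] .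
  show ?thesis
  \<comment> \<open>The factor \<open>m\<close> comes from differentiating
    \<open>t ^ m\<close>.\<close>
  proof (rule that[of x "\<rho> * real m"])
    show "x v > 0" if "v \<in> verts G" for v by (rule pos[OF that])
    fix v assume v: "v \<in> verts G"
    define F where "F = edge_sum (\<lambda>_. 1) G x v"
    define a where "a = (\<Sum>e | e \<in> edges G \<and> v \<notin> e. \<Prod>u\<in>e. x u)"
    define b where "b = (\<Sum>u\<in>verts G - {v}. x u ^ m)"
    \<comment> \<open>The slack at \<open>x(v := t)\<close>; \<open>a\<close> and \<open>b\<close>
      collect the terms free of \<open>v\<close>.\<close>
    define g where "g t = \<rho> * (t ^ m + b) - (t * F + a)" for t
    have fin: "finite (verts G)" using wf by (simp add: wf_hypergraph_def)
    have sum_upd: "(\<Sum>u\<in>verts G. (x(v := t)) u ^ m) = t ^ m + b" for t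
    proof -
      have "(\<Sum>u\<in>verts G - {v}. (x(v := t)) u ^ m) = b"
        unfolding b_def by (rule sum.cong) auto
      then show ?thesis by (simp add: sum.remove[OF fin v])
    qed
    have "g (x v) = 0"
      using edge_form_fun_upd[OF wf, of x v "x v"] sum_upd[of "x v"] x(3)
      by (simp add: g_def F_def a_def)
    moreover have "g t \<ge> 0" if "t \<ge> 0" for t
      using edge_form_fun_upd[OF wf, of x v t] sum_upd[of t] x(4)[of "x(v := t)"] x(1) that
      by (auto simp: g_def F_def a_def)
    \<comment> \<open>Within distance \<open>x v\<close> of \<open>x v\<close> every
      \<open>t\<close> is positive, so the slack is nonnegative there.\<close>
    ultimately have min: "\<forall>t. \<bar>x v - t\<bar> < x v \<longrightarrow> g (x v) \<le> g t" by auto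
    have "(g has_real_derivative \<rho> * (real m * x v ^ (m - 1)) - F) (at (x v))"
      unfolding g_def by (auto intro!: derivative_eq_intros)
    from DERIV_local_min[OF this pos[OF v] min]
    show "edge_sum (\<lambda>_. 1) G x v = \<rho> * real m * x v ^ (m - 1)"
      by (simp add: F_def)
  qed
qed


subsection \<open>Lifting eigenvectors to the covering\<close>

definition lift_edge :: "'v incidence_voltage \<Rightarrow> 'v set \<Rightarrow> nat \<Rightarrow> ('v \<times> nat) set" where
  "lift_edge \<phi> e i = (\<lambda>v. (v, \<phi> (Inl v, Inr e) i)) ` e"

lemma verts_covering [simp]: "verts (covering k H \<phi>) = verts H \<times> {1..k}"
  by (simp add: covering_def)

lemma edges_covering:
  "edges (covering k H \<phi>) = {lift_edge \<phi> e i | e i. e \<in> edges H \<and> i \<in> {1..k}}"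
  by (simp add: covering_def lift_edge_def Setcompr_eq_image)

lemma fst_image_lift_edge [simp]: "fst ` lift_edge \<phi> e i = e"
  by (force simp: lift_edge_def)

lemma voltage_permutes:
  assumes "wf_hypergraph H" and "voltage_assignment k (arcs_of (incidence_graph_edges H)) \<phi>"
    and "e \<in> edges H" "v \<in> e"
  shows "\<phi> (Inl v, Inr e) permutes {1..k}"
proof -
  have "v \<in> verts H" using assms(1,3,4) edge_subset_verts by blast
  then have "(Inl v, Inr e) \<in> arcs_of (incidence_graph_edges H)"
    using assms(3,4) by (auto simp: arcs_of_def incidence_graph_edges_def)
  with assms(2) show ?thesis by (auto simp: voltage_assignment_def)
qed

lemma uniform_covering:
  assumes "uniform m H"
  shows "uniform m (covering k H \<phi>)"
  using assms by (auto simp: uniform_def edges_covering lift_edge_def card_image inj_on_def)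

lemma wf_covering:
  assumes "wf_hypergraph H" and "voltage_assignment k (arcs_of (incidence_graph_edges H)) \<phi>"
  shows "wf_hypergraph (covering k H \<phi>)"
  unfolding wf_hypergraph_def
proof (intro conjI ballI subsetI)
  show "finite (verts (covering k H \<phi>))"
    using assms(1) by (simp add: wf_hypergraph_def)
  fix E p assume "E \<in> edges (covering k H \<phi>)" "p \<in> E"
  then obtain e i v where *: "e \<in> edges H" "i \<in> {1..k}" "v \<in> e" "p = (v, \<phi> (Inl v, Inr e) i)"
    by (auto simp: edges_covering lift_edge_def)
  then show "p \<in> verts (covering k H \<phi>)"
    using edge_subset_verts[OF assms(1)] permutes_in_image[OF voltage_permutes[OF assms *(1,3)]]
    by (auto simp del: atLeastAtMost_iff)
qed

text \<open>Since \<open>\<phi> (Inl v, Inr e)\<close> is a permutation, exactly one lift of each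
  edge at \<open>v\<close> passes through \<open>(v, j)\<close>: the one indexed by the preimage of
  \<open>j\<close>.\<close>

lemma edge_sum_covering:
  assumes wf: "wf_hypergraph H"
    and volt: "voltage_assignment k (arcs_of (incidence_graph_edges H)) \<phi>"
    and j: "j \<in> {1..k}"
  shows "edge_sum (\<lambda>_. 1) (covering k H \<phi>) y (v, j) =
    (\<Sum>e | e \<in> edges H \<and> v \<in> e.
      \<Prod>u\<in>e - {v}. y (u, \<phi> (Inl u, Inr e) (inv (\<phi> (Inl v, Inr e)) j)))"
proof -
  define i where "i e = inv (\<phi> (Inl v, Inr e)) j" for e
  have i: "i e \<in> {1..k}" "\<phi> (Inl v, Inr e) (i e) = j" if "e \<in> edges H" "v \<in> e" for e
    using voltage_permutes[OF wf volt that] j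
    by (simp_all add: i_def permutes_inverses permutes_in_image[OF permutes_inv] del: atLeastAtMost_iff)
  have i_eq: "i e = n" if "e \<in> edges H" "v \<in> e" "j = \<phi> (Inl v, Inr e) n" for e n
    using voltage_permutes[OF wf volt that(1,2)] that(3) by (simp add: i_def permutes_inverses)
  have "(\<Sum>e | e \<in> edges H \<and> v \<in> e. \<Prod>u\<in>e - {v}. y (u, \<phi> (Inl u, Inr e) (i e))) =
      (\<Sum>E | E \<in> edges (covering k H \<phi>) \<and> (v, j) \<in> E. 1 * (\<Prod>p\<in>E - {(v, j)}. y p))"
  proof (rule sum.reindex_bij_witness[of _ "image fst" "\<lambda>e. lift_edge \<phi> e (i e)"])
    fix e assume "e \<in> {e. e \<in> edges H \<and> v \<in> e}"
    then have e: "e \<in> edges H" "v \<in> e" by auto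
    show "fst ` lift_edge \<phi> e (i e) = e" by simp
    show "lift_edge \<phi> e (i e) \<in> {E. E \<in> edges (covering k H \<phi>) \<and> (v, j) \<in> E}"
      using e i[OF e] unfolding edges_covering by (auto simp: lift_edge_def)
    \<comment> \<open>A lift has just one vertex over each vertex of \<open>e\<close>, so removing
      \<open>(v, j)\<close> removes everything over \<open>v\<close>.\<close>
    have "lift_edge \<phi> e (i e) - {(v, j)} = (\<lambda>u. (u, \<phi> (Inl u, Inr e) (i e))) ` (e - {v})"
      using i(2)[OF e] by (auto simp: lift_edge_def)
    then show "1 * (\<Prod>p\<in>lift_edge \<phi> e (i e) - {(v, j)}. y p) =
        (\<Prod>u\<in>e - {v}. y (u, \<phi> (Inl u, Inr e) (i e)))"
      by (simp add: prod.reindex inj_on_def)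
  next
    fix E assume "E \<in> {E. E \<in> edges (covering k H \<phi>) \<and> (v, j) \<in> E}"
    then obtain e n where E: "E = lift_edge \<phi> e n" and e: "e \<in> edges H" and vj: "(v, j) \<in> lift_edge \<phi> e n"
      by (auto simp: edges_covering)
    then have v: "v \<in> e" "j = \<phi> (Inl v, Inr e) n" by (auto simp: lift_edge_def)
    show "lift_edge \<phi> (fst ` E) (i (fst ` E)) = E"
      using E i_eq[OF e v] by simp
    show "fst ` E \<in> {e. e \<in> edges H \<and> v \<in> e}" using E e v by simp
  qed
  then show ?thesis by (simp add: edge_sum_def i_def)
qed

text \<open>With \<open>s = 1\<close> and \<open>\<sigma> = 1\<close> this is the constant lift; for \<open>k = 2\<close> the lift with
  \<open>s 1 = 1\<close>, \<open>s 2 = - 1\<close> and \<open>\<sigma> = sign\<close> turns voltages into edge signs.\<close>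

lemma edge_sum_covering_lift:
  fixes x :: "'v \<Rightarrow> 'a::comm_ring_1"
  assumes wf: "wf_hypergraph H" and unif: "uniform m H"
    and volt: "voltage_assignment k (arcs_of (incidence_graph_edges H)) \<phi>"
    and s: "\<And>\<pi> i. \<pi> permutes {1..k} \<Longrightarrow> i \<in> {1..k} \<Longrightarrow> s (\<pi> i) = \<sigma> \<pi> * s i"
    and \<sigma>: "\<And>\<pi>. \<pi> permutes {1..k} \<Longrightarrow> \<sigma> \<pi> ^ m = 1"
    and v: "v \<in> verts H" and j: "j \<in> {1..k}"
  shows "edge_sum (\<lambda>_. 1) (covering k H \<phi>) (\<lambda>(u, i). s i * x u) (v, j) =
    s j ^ (m - 1) * edge_sum (\<lambda>e. \<Prod>u\<in>e. \<sigma> (\<phi> (Inl u, Inr e))) H x v"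
  unfolding edge_sum_covering[OF wf volt j]
  unfolding edge_sum_def sum_distrib_left
proof (rule sum.cong[OF refl])
  fix e assume "e \<in> {e. e \<in> edges H \<and> v \<in> e}"
  then have e: "e \<in> edges H" "v \<in> e" by auto
  define i where "i = inv (\<phi> (Inl v, Inr e)) j"
  define c where "c u = \<sigma> (\<phi> (Inl u, Inr e))" for u
  note perm = voltage_permutes[OF wf volt e(1)]
  have i: "i \<in> {1..k}" "\<phi> (Inl v, Inr e) i = j"
    using perm[OF e(2)] j
    by (simp_all add: i_def permutes_inverses permutes_in_image[OF permutes_inv] del: atLeastAtMost_iff)
  have sj: "s j = c v * s i" using s[OF perm[OF e(2)] i(1)] i(2) by (simp add: c_def)
  have fin: "finite e" "card e = m" using e unif finite_edge[OF wf] by (auto simp: uniform_def)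
  then have card: "card (e - {v}) = m - 1" "m > 0" using e(2) card_gt_0_iff[of e] by auto
  \<comment> \<open>As \<open>c v ^ m = 1\<close>, passing from \<open>s i\<close> to
    \<open>s j\<close> in the power leaves one factor \<open>c v\<close>, exactly the one missing
    from the product over \<open>e - {v}\<close>.\<close>
  have "c v ^ (m - 1) * c v = 1"
    using \<sigma>[OF perm[OF e(2)]] card(2) power_minus_mult[of m "c v"] by (simp add: c_def)
  moreover have "s j ^ (m - 1) * c v = (c v ^ (m - 1) * c v) * s i ^ (m - 1)"
    by (simp only: sj power_mult_distrib mult_ac)
  ultimately have si: "s i ^ (m - 1) = s j ^ (m - 1) * c v" by simp
  have "(\<Prod>u\<in>e - {v}. s (\<phi> (Inl u, Inr e) i) * x u) = (\<Prod>u\<in>e - {v}. c u * s i * x u)"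
    using s[OF perm i(1)] by (intro prod.cong) (auto simp: c_def)
  also have "\<dots> = s i ^ (m - 1) * (\<Prod>u\<in>e - {v}. c u) * (\<Prod>u\<in>e - {v}. x u)"
    by (simp add: prod.distrib card mult_ac)
  also have "\<dots> = s j ^ (m - 1) * ((\<Prod>u\<in>e. c u) * (\<Prod>u\<in>e - {v}. x u))"
    unfolding si by (simp add: prod.remove[OF fin(1) e(2), of c] mult_ac)
  finally show "(\<Prod>u\<in>e - {v}. case (u, \<phi> (Inl u, Inr e) (inv (\<phi> (Inl v, Inr e)) j)) of (u, i) \<Rightarrow> s i * x u) =
      s j ^ (m - 1) * ((\<Prod>u\<in>e. \<sigma> (\<phi> (Inl u, Inr e))) * (\<Prod>u\<in>e - {v}. x u))"
    by (simp add: i_def c_def)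
qed

text \<open>On sheet \<open>j\<close> the edge sum and the power of the lifted vector both pick up
  \<open>s j ^ (m - 1)\<close>, so the eigenvalue is unchanged. Sheet \<open>1\<close> carries a
  plain copy of \<open>x\<close>, which keeps the lift nonzero.\<close>

lemma hypergraph_eigenvalue_covering:
  assumes wf: "wf_hypergraph H" and unif: "uniform m H" and k: "k \<ge> 1"
    and volt: "voltage_assignment k (arcs_of (incidence_graph_edges H)) \<phi>"
    and s: "\<And>\<pi> i. \<pi> permutes {1..k} \<Longrightarrow> i \<in> {1..k} \<Longrightarrow> s (\<pi> i) = \<sigma> \<pi> * s i"
    and s1: "s 1 = 1"
    and \<sigma>: "\<And>\<pi>. \<pi> permutes {1..k} \<Longrightarrow> \<sigma> \<pi> ^ m = 1"
    and x: "\<exists>v\<in>verts H. x v \<noteq> (0::complex)"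
    and eig: "\<And>v. v \<in> verts H \<Longrightarrow>
      edge_sum (\<lambda>e. \<Prod>u\<in>e. \<sigma> (\<phi> (Inl u, Inr e))) H x v = \<mu> * x v ^ (m - 1)"
  shows "hypergraph_eigenvalue m (covering k H \<phi>) \<mu>"
  unfolding hypergraph_eigenvalue_iff[OF wf_covering[OF wf volt] uniform_covering[OF unif]]
proof (intro exI[of _ "\<lambda>(u, i). s i * x u"] conjI)
  show "\<exists>p\<in>verts (covering k H \<phi>). (case p of (u, i) \<Rightarrow> s i * x u) \<noteq> 0"
    using x k s1 by (force intro: bexI[of _ "(_, 1)"])
  show "\<forall>p\<in>verts (covering k H \<phi>). edge_sum (\<lambda>_. 1) (covering k H \<phi>) (\<lambda>(u, i). s i * x u) p =
      \<mu> * (case p of (u, i) \<Rightarrow> s i * x u) ^ (m - 1)"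
  proof
    fix p assume "p \<in> verts (covering k H \<phi>)"
    then obtain v j where p: "p = (v, j)" "v \<in> verts H" "j \<in> {1..k}" by auto
    show "edge_sum (\<lambda>_. 1) (covering k H \<phi>) (\<lambda>(u, i). s i * x u) p =
        \<mu> * (case p of (u, i) \<Rightarrow> s i * x u) ^ (m - 1)"
      using edge_sum_covering_lift[of H m k \<phi> s \<sigma>, OF wf unif volt s \<sigma> p(2,3), of x] eig[OF p(2)]
      by (simp add: p(1) power_mult_distrib)
  qed
qed

section \<open>Signs on two sheets, and the assembly of the three claims\<close>

text \<open>Only the identity and the transposition occur: one fixes both values, the other
  exchanges \<open>1\<close> and \<open>- 1\<close>.\<close>

lemma sign_permutes_two:
  fixes s :: "nat \<Rightarrow> complex"
  assumes "\<pi> permutes {1..2}" and "i \<in> {1..2}" and "s 1 = 1" and "s 2 = - 1"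
  shows "s (\<pi> i) = of_int (sign \<pi>) * s i"
proof -
  have two: "{1..2} = {1, 2::nat}" by auto
  have "\<pi> = id \<or> \<pi> = transpose 1 2"
    using assms(1) permutes_doubleton_iff[of \<pi> 1 2] unfolding two by simp
  then show ?thesis
    using assms(2-4) unfolding two by (auto simp: sign_swap_id sign_id)
qed

theorem theorem4p1:
  fixes H :: "'v hypergraph" and m k :: nat and \<phi> :: "'v incidence_voltage"
  assumes "wf_hypergraph H" and "uniform m H" and "connected_hypergraph H"
    and "k \<ge> 1"
    and "voltage_assignment k (arcs_of (incidence_graph_edges H)) \<phi>"
  shows "(\<forall>\<mu>. hypergraph_eigenvalue m H \<mu> \<longrightarrow> hypergraph_eigenvalue m (covering k H \<phi>) \<mu>) \<and>
    hypergraph_spectral_radius m (covering k H \<phi>) = hypergraph_spectral_radius m H \<and>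
    (k = 2 \<and> even m \<longrightarrow>
      (\<forall>\<mu>. signed_hypergraph_eigenvalue m (signed_of_voltage H \<phi>) \<mu> \<longrightarrow>
           hypergraph_eigenvalue m (covering k H \<phi>) \<mu>))"
proof (intro conjI allI impI)
  note wf = assms(1) and unif = assms(2) and k = assms(4) and volt = assms(5)
  have ne: "verts H \<noteq> {}" using assms(3) by (simp add: connected_hypergraph_def)
  show "hypergraph_eigenvalue m (covering k H \<phi>) \<mu>" if "hypergraph_eigenvalue m H \<mu>" for \<mu>
  proof -
    obtain x where "\<exists>v\<in>verts H. x v \<noteq> 0"
      and "\<And>v. v \<in> verts H \<Longrightarrow> edge_sum (\<lambda>_. 1) H x v = \<mu> * x v ^ (m - 1)"
      using \<open>hypergraph_eigenvalue m H \<mu>\<close> hypergraph_eigenvalue_iff[OF wf unif] by auto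
    then show ?thesis
      by (intro hypergraph_eigenvalue_covering[OF wf unif k volt, of "\<lambda>_. 1" "\<lambda>_. 1" x]) auto
  qed
  show "hypergraph_spectral_radius m (covering k H \<phi>) = hypergraph_spectral_radius m H"
  proof -
    obtain x \<rho> where pos: "\<And>v. v \<in> verts H \<Longrightarrow> x v > (0::real)"
      and eig: "\<And>v. v \<in> verts H \<Longrightarrow> edge_sum (\<lambda>_. 1) H x v = \<rho> * x v ^ (m - 1)"
      by (rule positive_eigenvector_exists[OF wf unif assms(3)]) blast
    \<comment> \<open>The covering may be disconnected, so its positive eigenvector is obtained by
      lifting that of \<open>H\<close>; both spectral radii then equal the same
      \<open>\<rho>\<close>.\<close>
    have "edge_sum (\<lambda>_. 1) (covering k H \<phi>) (\<lambda>(u, i). x u) (v, j) = \<rho> * x v ^ (m - 1)"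
      if "v \<in> verts H" "j \<in> {1..k}" for v j
      using edge_sum_covering_lift[OF wf unif volt _ _ that, of "\<lambda>_. 1" "\<lambda>_. 1" x] eig[OF that(1)]
      by simp
    then have "hypergraph_spectral_radius m (covering k H \<phi>) = \<rho>"
      using pos ne k
      by (intro spectral_radius_eq_of_positive_eigenvector[OF wf_covering[OF wf volt]
            uniform_covering[OF unif], of "\<lambda>(u, i). x u"]) auto
    moreover have "hypergraph_spectral_radius m H = \<rho>"
      by (rule spectral_radius_eq_of_positive_eigenvector[OF wf unif ne pos eig])
    ultimately show ?thesis by simp
  qed
  fix \<mu> assume "k = 2 \<and> even m" and ev: "signed_hypergraph_eigenvalue m (signed_of_voltage H \<phi>) \<mu>"
  then have k2: "k = 2" and "even m" by auto
  define \<Gamma> where "\<Gamma> = signed_of_voltage H \<phi>"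
  define w where "w e = (\<Prod>v\<in>e. complex_of_int (sign (\<phi> (Inl v, Inr e))))" for e
  have \<Gamma>: "verts \<Gamma> = verts H" "edges \<Gamma> = edges H" "of_int (edge_sign \<Gamma> e) = w e" for e
    by (simp_all add: \<Gamma>_def signed_of_voltage_def w_def)
  have "wf_hypergraph \<Gamma>" "uniform m \<Gamma>"
    using wf unif by (simp_all add: wf_hypergraph_def uniform_def \<Gamma>)
  \<comment> \<open>The signed tensor is a weighted adjacency tensor whose weights \<open>w\<close>
    are the edge signs read as complex numbers.\<close>
  from tensor_eigenvalue_iff_edge_sum[OF this, of "signed_adjacency_tensor m \<Gamma>" w \<mu>] ev
  obtain x where x: "\<exists>v\<in>verts H. x v \<noteq> 0"
    and eig: "\<And>v. v \<in> verts H \<Longrightarrow> edge_sum w H x v = \<mu> * x v ^ (m - 1)"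
    unfolding signed_hypergraph_eigenvalue_def \<Gamma>_def[symmetric]
    by (auto simp: signed_adjacency_tensor_def \<Gamma> edge_sum_def)
  define s :: "nat \<Rightarrow> complex" where "s i = (if i = 1 then 1 else - 1)" for i
  show "hypergraph_eigenvalue m (covering k H \<phi>) \<mu>"
  proof (rule hypergraph_eigenvalue_covering[OF wf unif k volt _ _ _ x, where s = s])
    show "s (\<pi> i) = of_int (sign \<pi>) * s i" if "\<pi> permutes {1..k}" "i \<in> {1..k}" for \<pi> i
      using that unfolding k2 by (rule sign_permutes_two) (simp_all add: s_def)
    show "s 1 = 1" by (simp add: s_def)
    \<comment> \<open>Evenness of \<open>m\<close> turns the \<open>m\<close>-th power of a sign
      into \<open>1\<close>.\<close>
    show "of_int (sign \<pi>) ^ m = (1::complex)" for \<pi> :: "nat \<Rightarrow> nat"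
      using \<open>even m\<close> by (simp add: sign_def)
    show "edge_sum (\<lambda>e. \<Prod>u\<in>e. of_int (sign (\<phi> (Inl u, Inr e)))) H x v = \<mu> * x v ^ (m - 1)"
      if "v \<in> verts H" for v
      using eig[OF that] by (simp add: w_def[abs_def])
  qed
qed

end
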